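(* Let $K$ be a real quadratic number field with ring of integers $\mathcal{O}_K$, and let $P=[a_0,\dots,a_N,\overline{a_{N+1},\dots,a_{N+k}}]$ be an ultimately periodic continued fraction with all partial quotients $a_i\in\mathcal{O}_K$. Let $f(P)=E_{21}x^2+(E_{22}-E_{11})x-E_{12}$ be the quadratic polynomial associated to $P$, and let $\Delta=(E_{22}-E_{11})^2+4E_{12}E_{21}$ be its discriminant. If $\Delta$ is positive and is not a square in $K$, then the continued fraction $P$ converges. If $\Delta$ is negative, then the continued fraction $P$ does not converge.
   Context: For $\alpha\in\mathbb{C}$ let $D(\alpha)=\begin{bmatrix} \alpha & 1 \\ 1 & 0 \end{bmatrix}$. For an ultimately periodic continued fraction $P=[a_0,\dots,a_N,\overline{a_{N+1},\dots,a_{N+k}}]$ define $$E(P)=\begin{bmatrix} E_{11} & E_{12} \\ E_{21} & E_{22} \end{bmatrix}=\big(D(a_0)\cdots D(a_N)\big)\big(D(a_{N+1})\cdots D(a_{N+k})\big)\big(D(a_0)\cdots D(a_N)\big)^{-1}.$$ The notation means that the infinite sequence of partial quotients consists of $a_0,\dots,a_N$ followed by the block $a_{N+1},\dots,a_{N+k}$ repeated forever; partial quotients $a_i$ with $i\ge1$ are nonzero, but may be negative. With $P_{-1}=1,\ P_0=a_0,\ P_{n+1}=a_{n+1}P_n+P_{n-1}$ and $Q_{-1}=0,\ Q_0=1,\ Q_{n+1}=a_{n+1}Q_n+Q_{n-1}$, the continued fraction converges if the sequence $P_n/Q_n$, viewed in $\mathbb{P}^1(\mathbb{C})$, has a limit.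 *)

theory Defs
  imports
    "HOL-Analysis.Analysis"
    "HOL-Computational_Algebra.Polynomial"
    "HOL-Library.Quadratic_Discriminant"
begin

text \<open>A real quadratic field is taken together with its embedding into the reals, that is, as a
  subfield of the reals; the sign of an element of the field refers to this embedding.\<close>

lemma vector_space_rat_real: "vector_space (\<lambda>(r::rat) (x::real). of_rat r * x)"
  by unfold_locales (simp_all add: of_rat_add of_rat_mult algebra_simps)

definition is_subfield :: "'a::field set \<Rightarrow> bool" where
  "is_subfield K \<longleftrightarrow> 0 \<in> K \<and> 1 \<in> K \<and>
     (\<forall>x\<in>K. \<forall>y\<in>K. x + y \<in> K \<and> x * y \<in> K) \<and> (\<forall>x\<in>K. - x \<in> K \<and> inverse x \<in> K)"

text \<open>The library dimension of an infinite-dimensional space is 0, so dimension 2 really means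
  that there is a rational basis with two elements.\<close>

definition real_quadratic_field :: "real set \<Rightarrow> bool" where
  "real_quadratic_field K \<longleftrightarrow>
     is_subfield K \<and> vector_space.dim (\<lambda>(r::rat) (x::real). of_rat r * x) K = 2"

definition ring_of_integers :: "'a::field_char_0 set \<Rightarrow> 'a set" where
  "ring_of_integers K = {x \<in> K. algebraic_int x}"

definition cf_D :: "'a::field \<Rightarrow> 'a ^ 2 ^ 2" where
  "cf_D \<alpha> = vector [vector [\<alpha>, 1], vector [1, 0]]"

text \<open>\<open>cf_D_prod a m l\<close> is the product of the \<open>l\<close> matrices
  \<open>D(a m) \<cdots> D(a (m + l - 1))\<close>, in this order.\<close>

primrec cf_D_prod :: "(nat \<Rightarrow> 'a::field) \<Rightarrow> nat \<Rightarrow> nat \<Rightarrow> 'a ^ 2 ^ 2" where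
  "cf_D_prod a m 0 = mat 1"
| "cf_D_prod a m (Suc l) = cf_D_prod a m l ** cf_D (a (m + l))"

text \<open>The continued fraction is given by its whole sequence of partial quotients; the
  preperiod is \<open>a 0, \<dots>, a N\<close> and the repeated block is \<open>a (N + 1), \<dots>, a (N + k)\<close>. Neither \<open>N\<close> nor \<open>k\<close> has to be minimal, and the
  matrix \<open>cf_E\<close> depends on the choice of \<open>k\<close>.\<close>

definition ultimately_periodic_cf :: "(nat \<Rightarrow> 'a::field) \<Rightarrow> nat \<Rightarrow> nat \<Rightarrow> bool" where
  "ultimately_periodic_cf a N k \<longleftrightarrow>
     k \<ge> 1 \<and> (\<forall>i\<ge>1. a i \<noteq> 0) \<and> (\<forall>i>N. a (i + k) = a i)"

definition cf_E :: "(nat \<Rightarrow> 'a::field) \<Rightarrow> nat \<Rightarrow> nat \<Rightarrow> 'a ^ 2 ^ 2" where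
  "cf_E a N k =
     cf_D_prod a 0 (Suc N) ** cf_D_prod a (Suc N) k ** matrix_inv (cf_D_prod a 0 (Suc N))"

definition cf_poly :: "(nat \<Rightarrow> 'a::field) \<Rightarrow> nat \<Rightarrow> nat \<Rightarrow> 'a poly" where
  "cf_poly a N k = (let E = cf_E a N k in [: - (E $ 1 $ 2), E $ 2 $ 2 - E $ 1 $ 1, E $ 2 $ 1 :])"

definition cf_disc :: "(nat \<Rightarrow> 'a::field) \<Rightarrow> nat \<Rightarrow> nat \<Rightarrow> 'a" where
  "cf_disc a N k =
     (let E = cf_E a N k in (E $ 2 $ 2 - E $ 1 $ 1)\<^sup>2 + 4 * (E $ 1 $ 2) * (E $ 2 $ 1))"

lemma cf_disc_eq_discrim:
  "cf_disc a N k =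
     discrim (coeff (cf_poly a N k) 2) (coeff (cf_poly a N k) 1) (coeff (cf_poly a N k) 0)"
  by (simp add: cf_disc_def cf_poly_def discrim_def Let_def numeral_2_eq_2)

text \<open>Numerators and denominators of the convergents; the second equations come from the initial
  values \<open>P\<^sub>-\<^sub>1 = 1\<close> and \<open>Q\<^sub>-\<^sub>1 = 0\<close>.\<close>

fun cf_P :: "(nat \<Rightarrow> 'a::field) \<Rightarrow> nat \<Rightarrow> 'a" where
  "cf_P a 0 = a 0"
| "cf_P a (Suc 0) = a 1 * a 0 + 1"
| "cf_P a (Suc (Suc n)) = a (Suc (Suc n)) * cf_P a (Suc n) + cf_P a n"

fun cf_Q :: "(nat \<Rightarrow> 'a::field) \<Rightarrow> nat \<Rightarrow> 'a" where
  "cf_Q a 0 = 1"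
| "cf_Q a (Suc 0) = a 1 * 1 + 0"
| "cf_Q a (Suc (Suc n)) = a (Suc (Suc n)) * cf_Q a (Suc n) + cf_Q a n"

text \<open>A point of the projective line is a complex line through the origin of
  \<open>\<complex> \<times> \<complex>\<close>; the topology is the quotient topology from the nonzero vectors.\<close>

definition proj_point :: "complex \<times> complex \<Rightarrow> (complex \<times> complex) set" where
  "proj_point v = {(c * fst v, c * snd v) | c. True}"

definition proj_line :: "(complex \<times> complex) set topology" where
  "proj_line = topology (\<lambda>U. U \<subseteq> proj_point ` (- {0}) \<and> open {v. v \<noteq> 0 \<and> proj_point v \<in> U})"

lemma openin_proj_line:
  "openin proj_line U \<longleftrightarrow>
     U \<subseteq> proj_point ` (- {0}) \<and> open {v. v \<noteq> 0 \<and> proj_point v \<in> U}"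
proof -
  have "istopology (\<lambda>U. U \<subseteq> proj_point ` (- {0}) \<and> open {v. v \<noteq> 0 \<and> proj_point v \<in> U})"
    unfolding istopology_def
  proof (intro conjI allI impI)
    fix S T
    assume "S \<subseteq> proj_point ` (- {0}) \<and> open {v. v \<noteq> 0 \<and> proj_point v \<in> S}"
      and "T \<subseteq> proj_point ` (- {0}) \<and> open {v. v \<noteq> 0 \<and> proj_point v \<in> T}"
    moreover have "{v. v \<noteq> 0 \<and> proj_point v \<in> S \<inter> T} =
        {v. v \<noteq> 0 \<and> proj_point v \<in> S} \<inter> {v. v \<noteq> 0 \<and> proj_point v \<in> T}"
      by auto
    ultimately show "S \<inter> T \<subseteq> proj_point ` (- {0})"
      and "open {v. v \<noteq> 0 \<and> proj_point v \<in> S \<inter> T}"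
      by (blast, simp add: open_Int)
  next
    fix \<K>
    assume *: "\<forall>S\<in>\<K>. S \<subseteq> proj_point ` (- {0}) \<and> open {v. v \<noteq> 0 \<and> proj_point v \<in> S}"
    then show "\<Union>\<K> \<subseteq> proj_point ` (- {0})"
      by blast
    have "{v. v \<noteq> 0 \<and> proj_point v \<in> \<Union>\<K>} = (\<Union>S\<in>\<K>. {v. v \<noteq> 0 \<and> proj_point v \<in> S})"
      by auto
    with * show "open {v. v \<noteq> 0 \<and> proj_point v \<in> \<Union>\<K>}"
      by auto
  qed
  then show ?thesis
    by (simp add: proj_line_def)
qed

lemma topspace_proj_line: "topspace proj_line = proj_point ` (- {0})"
proof -
  have "{v. v \<noteq> 0 \<and> proj_point v \<in> proj_point ` (- {0})} = - {0}"
    by auto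
  then have "openin proj_line (proj_point ` (- {0}))"
    by (simp add: openin_proj_line open_Compl)
  then show ?thesis
    by (meson openin_proj_line openin_subset openin_topspace subset_antisym)
qed

lemma quotient_map_proj_point:
  "quotient_map (top_of_set (- {0})) proj_line proj_point"
  unfolding quotient_map_def topspace_proj_line
proof (intro conjI allI impI)
  fix U
  assume "U \<subseteq> proj_point ` (- {0})"
  moreover have "{x. x \<noteq> 0 \<and> proj_point x \<in> U} \<subseteq> - {0}"
    by auto
  moreover have "open (- {0 :: complex \<times> complex})"
    by (simp add: open_Compl)
  ultimately show
    "openin (top_of_set (- {0})) {x \<in> topspace (top_of_set (- {0})). proj_point x \<in> U} =
      openin proj_line U"
    by (simp add: openin_proj_line openin_open_eq)
qed simp

text \<open>The vector \<open>(P\<^sub>n, Q\<^sub>n)\<close> is never zero, so the convergents always define points of the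
  projective line, also when \<open>Q\<^sub>n = 0\<close>.\<close>

lemma cf_P_cf_Q_det:
  "cf_P a (Suc n) * cf_Q a n - cf_P a n * cf_Q a (Suc n) = (- 1) ^ n"
proof (induction n)
  case (Suc n)
  have "cf_P a (Suc (Suc n)) * cf_Q a (Suc n) - cf_P a (Suc n) * cf_Q a (Suc (Suc n)) =
      - (cf_P a (Suc n) * cf_Q a n - cf_P a n * cf_Q a (Suc n))"
    by (simp add: algebra_simps)
  then show ?case
    by (simp only: Suc.IH) simp
qed (simp add: algebra_simps)

lemma cf_P_cf_Q_nonzero: "(cf_P a n, cf_Q a n) \<noteq> 0"
  using cf_P_cf_Q_det[of a n] by (auto simp: zero_prod_def)

definition cf_converges :: "(nat \<Rightarrow> complex) \<Rightarrow> bool" where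
  "cf_converges a \<longleftrightarrow>
     (\<exists>L. limitin proj_line (\<lambda>n. proj_point (cf_P a n, cf_Q a n)) L sequentially)"

end

theory Submission
  imports Defs
begin

text \<open>
  Put \<open>v\<^sub>n = (P\<^sub>n, Q\<^sub>n)\<close> and \<open>E = E(P)\<close>. Then \<open>v\<^sub>n\<^sub>+\<^sub>k = E v\<^sub>n\<close> for \<open>n \<ge> N\<close>, and
  \<open>det E = (-1)\<^sup>k\<close>, so \<open>\<Delta>\<close> is the discriminant of the characteristic polynomial of \<open>E\<close>.

  If \<open>\<Delta> > 0\<close> is not a square in \<open>K\<close>, the eigenvalues of \<open>E\<close> are real, lie outside \<open>K\<close>, and have
  different absolute values (trace zero would force \<open>\<Delta> = 4\<close>). Since \<open>v\<^sub>n\<close> has entries in \<open>K\<close>, it is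
  never an eigenvector, so its component along the dominant eigenvector is nonzero, and all the
  sequences \<open>E\<^sup>j v\<^sub>n\<close> converge projectively to the dominant eigenline.

  If \<open>\<Delta> < 0\<close>, the quadratic form \<open>F(v) = det(v, E v)\<close> is definite on real vectors. Hence the angle
  between \<open>v\<^sub>n\<close> and \<open>v\<^sub>n\<^sub>+\<^sub>k\<close> is bounded away from zero, which excludes convergence.
\<close>

section \<open>Convergents and the period matrix\<close>

lemma matrix_mult_2_nth:
  fixes A B :: "'a::semiring_1 ^ 2 ^ 2"
  shows "(A ** B) $ i $ j = A $ i $ 1 * B $ 1 $ j + A $ i $ 2 * B $ 2 $ j"
  by (simp add: matrix_matrix_mult_def sum_2)

lemma cf_D_nth [simp]:
  "cf_D x $ 1 $ 1 = x" "cf_D x $ 1 $ 2 = 1" "cf_D x $ 2 $ 1 = 1" "cf_D x $ 2 $ 2 = 0"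
  by (simp_all add: cf_D_def)

text \<open>Right multiplication by \<open>cf_D x\<close> moves the first column into the second and
  puts x times the first plus the second in its place. This is the recurrence of numerators and
  denominators.\<close>

lemma cf_D_prod_convergent:
  "cf_D_prod a 0 (Suc n) $ 1 $ 1 = cf_P a n \<and> cf_D_prod a 0 (Suc n) $ 2 $ 1 = cf_Q a n"
  by (induction n rule: cf_P.induct[of _ a]) (auto simp: matrix_mult_2_nth mat_def mult.commute)

lemma cf_D_prod_add: "cf_D_prod a m (l + l') = cf_D_prod a m l ** cf_D_prod a (m + l) l'"
  by (induction l') (simp_all add: matrix_mul_assoc add.assoc)

lemma det_cf_D_prod: "det (cf_D_prod a m l) = (- 1) ^ l"
proof (induction l)
  case (Suc l)
  have "det (cf_D (a (m + l))) = - 1"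
    by (simp add: det_2)
  with Suc show ?case
    by (simp add: det_mul)
qed simp

lemma cf_D_prod_periodic:
  assumes "\<And>i. i \<ge> m \<Longrightarrow> a (i + k) = a i"
  shows "cf_D_prod a (m + k) l = cf_D_prod a m l"
proof (induction l)
  case (Suc l)
  have "a (m + k + l) = a (m + l)"
    using assms[of "m + l"] by (simp add: ac_simps)
  with Suc show ?case
    by simp
qed simp

text \<open>The conjugation defining \<open>cf_E\<close> with its inverse cleared, legitimate
  because the preperiod product has determinant 1 or -1. Later arguments need only this
  form.\<close>

lemma cf_E_mult:
  "cf_E a N k ** cf_D_prod a 0 (Suc N) = cf_D_prod a 0 (Suc N) ** cf_D_prod a (Suc N) k"
proof -
  have "invertible (cf_D_prod a 0 (Suc N))"
    by (simp only: invertible_det_nz det_cf_D_prod) simp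
  then have "matrix_inv (cf_D_prod a 0 (Suc N)) ** cf_D_prod a 0 (Suc N) = mat 1"
    unfolding invertible_def matrix_inv_def by (rule someI_ex[THEN conjunct2])
  then show ?thesis
    by (simp only: cf_E_def matrix_mul_assoc[symmetric] matrix_mul_rid)
qed

lemma det_cf_E: "det (cf_E a N k) = (- 1) ^ k"
proof -
  have "det (cf_E a N k) * det (cf_D_prod a 0 (Suc N)) =
      det (cf_D_prod a 0 (Suc N)) * det (cf_D_prod a (Suc N) k)"
    by (simp only: det_mul[symmetric] cf_E_mult)
  then show ?thesis
    by (simp only: det_cf_D_prod) simp
qed

text \<open>Write the product up to n + k as preperiod A, one period B, remainder R. By periodicity
  A R is the product up to n, and A B R = E A R. Comparing first columns gives both
  equations.\<close>

lemma cf_convergent_shift: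
  assumes "ultimately_periodic_cf a N k" and "n \<ge> N"
  shows "cf_P a (n + k) = cf_E a N k $ 1 $ 1 * cf_P a n + cf_E a N k $ 1 $ 2 * cf_Q a n"
    and "cf_Q a (n + k) = cf_E a N k $ 2 $ 1 * cf_P a n + cf_E a N k $ 2 $ 2 * cf_Q a n"
proof -
  obtain r where n: "n = N + r"
    using assms(2) le_Suc_ex by blast
  have per: "cf_D_prod a (Suc N + k) r = cf_D_prod a (Suc N) r"
    using assms(1) by (intro cf_D_prod_periodic) (auto simp: ultimately_periodic_cf_def)
  have "cf_D_prod a 0 (Suc (n + k)) = cf_D_prod a 0 (Suc N + k + r)"
    by (simp add: n ac_simps)
  also have "\<dots> = cf_D_prod a 0 (Suc N) ** cf_D_prod a (Suc N) k ** cf_D_prod a (Suc N) r"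
    by (simp only: cf_D_prod_add per add_0)
  also have "\<dots> = cf_E a N k ** (cf_D_prod a 0 (Suc N) ** cf_D_prod a (Suc N) r)"
    by (simp only: cf_E_mult[symmetric] matrix_mul_assoc[symmetric])
  also have "\<dots> = cf_E a N k ** cf_D_prod a 0 (Suc n)"
    by (simp only: cf_D_prod_add[symmetric, of a 0, simplified] n add_Suc)
  finally have eq: "cf_D_prod a 0 (Suc (n + k)) = cf_E a N k ** cf_D_prod a 0 (Suc n)" .
  show "cf_P a (n + k) = cf_E a N k $ 1 $ 1 * cf_P a n + cf_E a N k $ 1 $ 2 * cf_Q a n"
    and "cf_Q a (n + k) = cf_E a N k $ 2 $ 1 * cf_P a n + cf_E a N k $ 2 $ 2 * cf_Q a n"
    using arg_cong[OF eq, of "\<lambda>M. M $ 1 $ 1"] arg_cong[OF eq, of "\<lambda>M. M $ 2 $ 1"]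
    by (simp_all only: matrix_mult_2_nth cf_D_prod_convergent)
qed

text \<open>Once the power of -1 is read as the determinant of E, this is a polynomial identity in
  the entries of E.\<close>

lemma cf_disc_eq_trace_det:
  "cf_disc a N k = (cf_E a N k $ 1 $ 1 + cf_E a N k $ 2 $ 2)\<^sup>2 - 4 * (- 1) ^ k"
  unfolding det_cf_E[of a N k, symmetric]
  by (simp add: cf_disc_def Let_def det_2 power2_eq_square algebra_simps)

lemma cf_P_of_real: "cf_P (\<lambda>i. complex_of_real (a i)) n = of_real (cf_P a n)"
  by (induction n rule: cf_P.induct[of _ a]) simp_all

lemma cf_Q_of_real: "cf_Q (\<lambda>i. complex_of_real (a i)) n = of_real (cf_Q a n)"
  by (induction n rule: cf_Q.induct[of _ a]) simp_all

lemma cf_P_Q_in_subfield: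
  assumes "is_subfield K" and "\<And>i. a i \<in> K"
  shows "cf_P a n \<in> K \<and> cf_Q a n \<in> K"
  using assms by (induction n rule: cf_P.induct[of _ a]) (auto simp: is_subfield_def)

section \<open>Convergence in the projective line\<close>

lemma proj_point_scale:
  assumes "c \<noteq> 0"
  shows "proj_point (c * x, c * y) = proj_point (x, y)"
proof -
  have "proj_point (c * x, c * y) = range (\<lambda>d. (d * (c * x), d * (c * y)))"
    by (auto simp: proj_point_def)
  also have "\<dots> = (\<lambda>d. (d * x, d * y)) ` range (\<lambda>d. d * c)"
    by (simp add: image_image mult.assoc)
  also have "range (\<lambda>d. d * c) = UNIV"
    using assms by (intro surjI[of _ "\<lambda>d. d / c"]) simp
  also have "range (\<lambda>d. (d * x, d * y)) = proj_point (x, y)"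
    by (auto simp: proj_point_def)
  finally show ?thesis .
qed

lemma limitin_proj_point:
  assumes "(v \<longlongrightarrow> u) F" and "u \<noteq> 0" and "\<forall>\<^sub>F n in F. v n \<noteq> 0"
  shows "limitin proj_line (\<lambda>n. proj_point (v n)) (proj_point u) F"
proof -
  have "limitin (top_of_set (- {0})) v u F"
    using assms by (auto simp: limitin_subtopology)
  then have "limitin proj_line (proj_point \<circ> v) (proj_point u) F"
    by (rule continuous_map_limit[OF quotient_imp_continuous_map[OF quotient_map_proj_point]])
  then show ?thesis
    by (simp add: comp_def)
qed

text \<open>The determinant of w and u, relative to the norm of w, depends only on the line of w and
  vanishes on the line of u. Bounding it by \<epsilon> therefore cuts out an open neighbourhood of
  that line.\<close>

lemma limitin_proj_pointD:
  assumes "limitin proj_line (\<lambda>n. proj_point (v n)) (proj_point u) F"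
    and "u \<noteq> 0" and "\<And>n. v n \<noteq> 0" and "\<epsilon> > 0"
  shows "\<forall>\<^sub>F n in F. cmod (fst (v n) * snd u - snd (v n) * fst u) < \<epsilon> * norm (v n)"
proof -
  define near where
    "near w \<longleftrightarrow> cmod (fst w * snd u - snd w * fst u) < \<epsilon> * norm w" for w :: "complex \<times> complex"
  define U where "U = proj_point ` {w. w \<noteq> 0 \<and> near w}"
  \<comment> \<open>Both sides of \<open>near\<close> are homogeneous of degree one in absolute
    value, so the preimage of \<open>U\<close> is no larger than the open set given by
    \<open>near\<close>.\<close>
  have near_cong: "near w" if near': "near w'" and eq: "proj_point w = proj_point w'" and "w \<noteq> 0" for w w'
  proof -
    have "w \<in> proj_point w"
      unfolding proj_point_def by (intro CollectI exI[of _ 1]) simp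
    then obtain c where c: "w = (c * fst w', c * snd w')"
      using eq by (auto simp: proj_point_def)
    have "norm w = cmod c * norm w'"
      by (subst c) (simp add: norm_prod_def norm_mult power_mult_distrib real_sqrt_mult
          distrib_left[symmetric])
    moreover have "cmod (fst w * snd u - snd w * fst u) =
        cmod c * cmod (fst w' * snd u - snd w' * fst u)"
      by (subst (1 2) c) (simp add: norm_mult[symmetric] algebra_simps)
    moreover have "c \<noteq> 0"
      using c \<open>w \<noteq> 0\<close> by (auto simp: zero_prod_def)
    ultimately show ?thesis
      using near' by (simp add: near_def mult.left_commute)
  qed
  have "{w. w \<noteq> 0 \<and> proj_point w \<in> U} = {w. w \<noteq> 0} \<inter> {w. near w}"
    using near_cong by (auto simp: U_def)
  moreover have "open {w :: complex \<times> complex. w \<noteq> 0}"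
    by (simp add: open_Collect_neq)
  moreover have "open {w. near w}"
    unfolding near_def by (intro open_Collect_less continuous_intros)
  ultimately have "openin proj_line U"
    unfolding openin_proj_line by (auto simp: U_def)
  moreover have "proj_point u \<in> U"
    using assms(2,4) by (auto simp: U_def near_def mult.commute)
  ultimately have "\<forall>\<^sub>F n in F. proj_point (v n) \<in> U"
    using assms(1) unfolding limitin_def by blast
  then show ?thesis
  proof (rule eventually_mono)
    fix n
    assume "proj_point (v n) \<in> U"
    then obtain w where "near w" "proj_point (v n) = proj_point w"
      by (auto simp: U_def)
    then have "near (v n)"
      using assms(3) by (rule near_cong)
    then show "cmod (fst (v n) * snd u - snd (v n) * fst u) < \<epsilon> * norm (v n)"
      by (simp add: near_def)
  qed
qed

section \<open>Positive discriminant\<close>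

text \<open>From N on, each residue class modulo k carries a geometric sequence of ratio q. There
  are finitely many classes, so one constant bounds them all.\<close>

lemma quasi_geometric_tendsto_0:
  fixes f :: "nat \<Rightarrow> real"
  assumes rec: "\<And>n. n \<ge> N \<Longrightarrow> f (n + k) = q * f n" and q: "\<bar>q\<bar> < 1" and "k \<ge> 1"
  shows "f \<longlonglongrightarrow> 0"
proof -
  have iter: "f (m + j * k) = q ^ j * f m" if "m \<ge> N" for m j
  proof (induction j)
    case (Suc j)
    have "f (m + Suc j * k) = f (m + j * k + k)"
      by (simp add: ac_simps)
    with Suc show ?case
      using rec[of "m + j * k"] that by simp
  qed simp
  define C where "C = (\<Sum>r<k. \<bar>f (N + r)\<bar>)"
  have bound: "\<bar>f (n + N)\<bar> \<le> \<bar>q\<bar> ^ (n div k) * C" for n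
  proof -
    have "f (n + N) = f ((N + n mod k) + (n div k) * k)"
      by (simp add: ac_simps)
    also have "\<dots> = q ^ (n div k) * f (N + n mod k)"
      by (rule iter) simp
    finally have "\<bar>f (n + N)\<bar> = \<bar>q\<bar> ^ (n div k) * \<bar>f (N + n mod k)\<bar>"
      by (simp add: abs_mult power_abs)
    moreover have "\<bar>f (N + n mod k)\<bar> \<le> C"
      unfolding C_def using \<open>k \<ge> 1\<close> by (intro member_le_sum) auto
    ultimately show ?thesis
      by (simp add: mult_left_mono)
  qed
  have "filterlim (\<lambda>n. n div k) sequentially sequentially"
    unfolding filterlim_at_top
  proof
    fix Z
    show "\<forall>\<^sub>F n in sequentially. Z \<le> n div k"
      using eventually_ge_at_top[of "Z * k"]
      by eventually_elim (use \<open>k \<ge> 1\<close> in \<open>simp add: less_eq_div_iff_mult_less_eq\<close>)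
  qed
  moreover have "(\<lambda>n. \<bar>q\<bar> ^ n) \<longlonglongrightarrow> 0"
    using q by (intro LIMSEQ_power_zero) simp
  ultimately have "(\<lambda>n. \<bar>q\<bar> ^ (n div k)) \<longlonglongrightarrow> 0"
    by (rule filterlim_compose[rotated])
  then have "(\<lambda>n. \<bar>q\<bar> ^ (n div k) * C) \<longlonglongrightarrow> 0"
    by (rule tendsto_mult_left_zero)
  then have "(\<lambda>n. f (n + N)) \<longlonglongrightarrow> 0"
    by (rule Lim_null_comparison[rotated]) (simp add: bound)
  then show ?thesis
    by (simp add: LIMSEQ_offset)
qed

text \<open>The roots of X^2 - t X + d are (t + s)/2 and (t - s)/2. Giving the square root s the
  sign of t makes the first one strictly larger in absolute value.\<close>

lemma dominant_root:
  fixes t d :: real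
  assumes "t\<^sup>2 - 4 * d > 0" and "t \<noteq> 0"
  obtains l m where "l + m = t" "l * m = d" "(l - m)\<^sup>2 = t\<^sup>2 - 4 * d" "\<bar>m\<bar> < \<bar>l\<bar>"
proof -
  define s where "s = sgn t * sqrt (t\<^sup>2 - 4 * d)"
  have s2: "s\<^sup>2 = t\<^sup>2 - 4 * d"
    using assms by (simp add: s_def power_mult_distrib sgn_if)
  have "t * s > 0"
    using assms by (simp add: s_def sgn_if mult_pos_pos mult_neg_pos)
  then have "((t - s) / 2)\<^sup>2 < ((t + s) / 2)\<^sup>2"
    by (simp add: power2_eq_square field_simps)
  then have "\<bar>(t - s) / 2\<bar> < \<bar>(t + s) / 2\<bar>"
    by (metis abs_le_square_iff not_le)
  then show ?thesis
    using s2 by (intro that[of "(t + s) / 2" "(t - s) / 2"])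
      (simp_all add: field_simps power2_eq_square)
qed

lemma parallel_scalar:
  fixes x y x' y' :: "'a::field"
  assumes "x * y' = y * x'" and "(x, y) \<noteq> (0, 0)"
  obtains c where "x' = c * x" "y' = c * y"
proof (cases "x = 0")
  case True
  then show ?thesis
    using assms by (intro that[of "y' / y"]) auto
next
  case False
  then show ?thesis
    using assms(1) by (intro that[of "x' / x"]) (auto simp: field_simps)
qed

lemma power_iteration_convergent:
  fixes p q :: "nat \<Rightarrow> real"
  assumes "k \<ge> 1"
    and recp: "\<And>n. n \<ge> N \<Longrightarrow> p (n + k) = e11 * p n + e12 * q n"
    and recq: "\<And>n. n \<ge> N \<Longrightarrow> q (n + k) = e21 * p n + e22 * q n"
    and tr: "l + m = e11 + e22" and dt: "l * m = e11 * e22 - e12 * e21"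
    and dom: "\<bar>m\<bar> < \<bar>l\<bar>"
    and not_eigen: "\<And>n. n \<ge> N \<Longrightarrow> (p (n + k), q (n + k)) \<noteq> (m * p n, m * q n)"
  shows "\<exists>L. limitin proj_line (\<lambda>n. proj_point (of_real (p n), of_real (q n))) L sequentially"
proof -
  \<comment> \<open>With v = (p, q), these are w = (E - m) v and, below, z = (E - l) v: multiples of
    the components of v along the eigenlines of l and m. They satisfy w - z = (l - m) v.\<close>
  define w1 w2 where "w1 n = p (n + k) - m * p n" and "w2 n = q (n + k) - m * q n" for n
  define z1 z2 where "z1 n = p (n + k) - l * p n" and "z2 n = q (n + k) - l * q n" for n
  have e22: "e22 = l + m - e11"
    using tr by simp
  have e: "e12 * e21 = e11 * (l + m - e11) - l * m"
    using dt e22 by simp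
  have w_ne: "(w1 n, w2 n) \<noteq> (0, 0)" if "n \<ge> N" for n
    using not_eigen[OF that] by (simp add: w1_def w2_def)
  \<comment> \<open>Cayley-Hamilton for E, applied to the vector with index n.\<close>
  have CHp: "p (n + k + k) = (l + m) * p (n + k) - l * m * p n"
    and CHq: "q (n + k + k) = (l + m) * q (n + k) - l * m * q n" if "n \<ge> N" for n
  proof -
    have ge: "n + k \<ge> N"
      using that by simp
    show "p (n + k + k) = (l + m) * p (n + k) - l * m * p n"
      unfolding recp[OF ge] recp[OF that] recq[OF that] tr dt by (simp add: algebra_simps)
    show "q (n + k + k) = (l + m) * q (n + k) - l * m * q n"
      unfolding recq[OF ge] recp[OF that] recq[OF that] tr dt by (simp add: algebra_simps)
  qed
  have w_rec: "w1 (n + k) = l * w1 n" "w2 (n + k) = l * w2 n"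
    and z_rec: "z1 (n + k) = m * z1 n" "z2 (n + k) = m * z2 n" if "n \<ge> N" for n
    unfolding w1_def w2_def z1_def z2_def CHp[OF that] CHq[OF that] by (simp_all add: algebra_simps)
  \<comment> \<open>\<open>E - m\<close> has determinant zero, so all vectors \<open>(E - m) v\<^sub>n\<close> lie on one line.\<close>
  have w_par: "w1 N * w2 n = w2 N * w1 n" if "n \<ge> N" for n
  proof -
    have "w1 N * w2 n - w2 N * w1 n =
        ((e11 - m) * (e22 - m) - e12 * e21) * (p N * q n - q N * p n)"
      unfolding w1_def w2_def recp[OF that] recq[OF that] recp[OF order_refl] recq[OF order_refl]
      by (simp add: algebra_simps)
    also have "(e11 - m) * (e22 - m) - e12 * e21 = 0"
      unfolding e e22 by (simp add: algebra_simps)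
    finally show ?thesis
      by simp
  qed
  have "\<exists>c. w1 n = c * w1 N \<and> w2 n = c * w2 N" if "n \<ge> N" for n
    using parallel_scalar[OF w_par[OF that] w_ne[OF order_refl]] by metis
  \<comment> \<open>\<open>c n\<close> is the coordinate of the n-th w relative to the one at N; it
    is multiplied by l in each period.\<close>
  then obtain c where c: "w1 n = c n * w1 N" "w2 n = c n * w2 N" if "n \<ge> N" for n
    by metis
  have c_ne: "c n \<noteq> 0" if "n \<ge> N" for n
    using c[OF that] w_ne[OF that] by auto
  have c_rec: "c (n + k) = l * c n" if "n \<ge> N" for n
  proof -
    have "n + k \<ge> N"
      using that by simp
    then have "c (n + k) * w1 N = l * c n * w1 N" "c (n + k) * w2 N = l * c n * w2 N"
      using w_rec[OF that] c[OF that] c[of "n + k"] by simp_all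
    with w_ne[of N] show ?thesis
      by auto
  qed
  have ml: "\<bar>m / l\<bar> < 1" "l \<noteq> 0" "l \<noteq> m"
    using dom by (auto simp: abs_divide)
  \<comment> \<open>Each period multiplies these quotients by m / l, so the component along the
    other eigenline dies out.\<close>
  have "(\<lambda>n. z1 n / c n) \<longlonglongrightarrow> 0" "(\<lambda>n. z2 n / c n) \<longlonglongrightarrow> 0"
    by (rule quasi_geometric_tendsto_0[where N = N and k = k and q = "m / l"];
        use ml \<open>k \<ge> 1\<close> in \<open>simp add: z_rec c_rec\<close>)+
  then have "(\<lambda>n. (complex_of_real (w1 N - z1 n / c n), complex_of_real (w2 N - z2 n / c n)))
      \<longlonglongrightarrow> (complex_of_real (w1 N - 0), complex_of_real (w2 N - 0))"
    by (intro tendsto_intros)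
  moreover have ne: "(complex_of_real (w1 N - 0), complex_of_real (w2 N - 0)) \<noteq> 0"
    using w_ne[of N] by (simp add: zero_prod_def)
  moreover have "\<forall>\<^sub>F n in sequentially.
      (complex_of_real (w1 N - z1 n / c n), complex_of_real (w2 N - z2 n / c n)) \<noteq> 0"
    using calculation by (rule tendsto_imp_eventually_ne)
  ultimately have lim: "limitin proj_line (\<lambda>n. proj_point
      (complex_of_real (w1 N - z1 n / c n), complex_of_real (w2 N - z2 n / c n)))
      (proj_point (complex_of_real (w1 N - 0), complex_of_real (w2 N - 0))) sequentially"
    by (rule limitin_proj_point)
  have "\<forall>\<^sub>F n in sequentially.
      proj_point (complex_of_real (w1 N - z1 n / c n), complex_of_real (w2 N - z2 n / c n)) =
      proj_point (of_real (p n), of_real (q n))"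
    using eventually_ge_at_top[of N]
  proof eventually_elim
    case (elim n)
    \<comment> \<open>Dividing w - z = (l - m) v by \<open>c n\<close> shows that the convergent
      vector and the convergent sequence above span the same line.\<close>
    define g where "g = (l - m) / c n"
    have "w1 N - z1 n / c n = g * p n" "w2 N - z2 n / c n = g * q n"
      using c[OF elim] c_ne[OF elim]
      by (simp_all add: g_def field_simps w1_def[of n] w2_def[of n] z1_def z2_def)
    moreover have "complex_of_real g \<noteq> 0"
      using ml c_ne[OF elim] by (simp add: g_def)
    ultimately show ?case
      by (simp add: proj_point_scale)
  qed
  then show ?thesis
    using lim by (intro exI) (rule limitin_transform_eventually)
qed

section \<open>Negative discriminant\<close>

text \<open>Complete the square in 4 a F and in 4 c F and add. When 4 a c - b^2 is positive, this
  bounds the form away from zero on the unit circle.\<close>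

lemma definite_form_lower_bound:
  fixes a b c x y :: real
  shows "(4 * a * c - b\<^sup>2) * (x\<^sup>2 + y\<^sup>2) \<le> 4 * (\<bar>a\<bar> + \<bar>c\<bar>) * \<bar>a * x\<^sup>2 + b * x * y + c * y\<^sup>2\<bar>"
proof -
  define F where "F = a * x\<^sup>2 + b * x * y + c * y\<^sup>2"
  have "4 * a * F = (2 * a * x + b * y)\<^sup>2 + (4 * a * c - b\<^sup>2) * y\<^sup>2"
    and "4 * c * F = (2 * c * y + b * x)\<^sup>2 + (4 * a * c - b\<^sup>2) * x\<^sup>2"
    by (simp_all add: F_def power2_eq_square algebra_simps)
  then have "4 * (a * F) + 4 * (c * F) = (2 * a * x + b * y)\<^sup>2 + (2 * c * y + b * x)\<^sup>2 +
      (4 * a * c - b\<^sup>2) * (x\<^sup>2 + y\<^sup>2)"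
    by (simp add: distrib_left)
  then have "(4 * a * c - b\<^sup>2) * (x\<^sup>2 + y\<^sup>2) \<le> 4 * (a * F) + 4 * (c * F)"
    by simp
  moreover have "a * F \<le> \<bar>a\<bar> * \<bar>F\<bar>" "c * F \<le> \<bar>c\<bar> * \<bar>F\<bar>"
    by (metis abs_ge_self abs_mult)+
  ultimately show ?thesis
    unfolding F_def[symmetric] by (simp add: distrib_left distrib_right)
qed

lemma norm_of_real_pair: "norm (complex_of_real x, complex_of_real y) = norm (x, y)"
  by (simp add: norm_prod_def)

lemma norm_linear_image_2_le:
  fixes x y :: real
  shows "norm (e11 * x + e12 * y, e21 * x + e22 * y) \<le>
    (\<bar>e11\<bar> + \<bar>e12\<bar> + \<bar>e21\<bar> + \<bar>e22\<bar>) * norm (x, y)"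
proof -
  have "norm (e11 * x + e12 * y, e21 * x + e22 * y) \<le>
      \<bar>e11 * x + e12 * y\<bar> + \<bar>e21 * x + e22 * y\<bar>"
    using norm_Pair_le[of "e11 * x + e12 * y" "e21 * x + e22 * y"] by simp
  also have "\<dots> \<le> \<bar>e11\<bar> * \<bar>x\<bar> + \<bar>e12\<bar> * \<bar>y\<bar> + \<bar>e21\<bar> * \<bar>x\<bar> + \<bar>e22\<bar> * \<bar>y\<bar>"
    unfolding abs_mult[symmetric] by linarith
  also have "\<dots> \<le> \<bar>e11\<bar> * norm (x, y) + \<bar>e12\<bar> * norm (x, y) + \<bar>e21\<bar> * norm (x, y) +
      \<bar>e22\<bar> * norm (x, y)"
    using norm_fst_le[of x y] norm_snd_le[of y x]
    by (intro add_mono mult_left_mono) auto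
  finally show ?thesis
    by (simp add: algebra_simps)
qed

text \<open>Two vectors close to the line of u are nearly parallel. It will be applied to convergent
  vectors one period apart.\<close>

lemma norm_det_le_of_close:
  fixes x y x' y' :: real and u :: "complex \<times> complex"
  assumes "cmod (of_real x * snd u - of_real y * fst u) \<le> \<epsilon> * norm (x, y)"
    and "cmod (of_real x' * snd u - of_real y' * fst u) \<le> \<epsilon> * norm (x', y')"
  shows "\<bar>x * y' - y * x'\<bar> * norm u \<le> 2 * (\<epsilon> * norm (x, y) * norm (x', y'))"
proof -
  define s where "s = of_real x * snd u - of_real y * fst u"
  define s' where "s' = of_real x' * snd u - of_real y' * fst u"
  define vec where "vec c a b = (c * complex_of_real a, c * complex_of_real b)" for c a b
  have norm_vec: "norm (vec c a b) = cmod c * norm (a, b)" for c a b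
    by (simp add: vec_def norm_prod_def norm_mult power_mult_distrib real_sqrt_mult
        distrib_left[symmetric])
  have "\<bar>x * y' - y * x'\<bar> * norm u = norm ((x * y' - y * x') *\<^sub>R u)"
    by simp
  \<comment> \<open>the linear relation between three vectors of the plane\<close>
  also have "(x * y' - y * x') *\<^sub>R u = vec s x' y' - vec s' x y"
    by (simp add: prod_eq_iff vec_def s_def s'_def scaleR_conv_of_real algebra_simps)
  also have "norm \<dots> \<le> cmod s * norm (x', y') + cmod s' * norm (x, y)"
    using norm_triangle_ineq4 norm_vec by metis
  also have "\<dots> \<le> (\<epsilon> * norm (x, y)) * norm (x', y') + (\<epsilon> * norm (x', y')) * norm (x, y)"
    using assms unfolding s_def s'_def by (intro add_mono mult_right_mono) auto
  finally show ?thesis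
    by (simp add: algebra_simps)
qed

text \<open>Near a limit line the determinant F of v and E v would be small compared with the
  squared norm of v, against the lower bound for a definite form.\<close>

lemma elliptic_iteration_divergent:
  fixes p q :: "nat \<Rightarrow> real"
  assumes recp: "\<And>n. n \<ge> N \<Longrightarrow> p (n + k) = e11 * p n + e12 * q n"
    and recq: "\<And>n. n \<ge> N \<Longrightarrow> q (n + k) = e21 * p n + e22 * q n"
    and disc: "(e22 - e11)\<^sup>2 + 4 * e12 * e21 < 0"
    and nz: "\<And>n. (p n, q n) \<noteq> 0"
  shows "\<not> limitin proj_line (\<lambda>n. proj_point (of_real (p n), of_real (q n))) L sequentially"
proof
  assume lim: "limitin proj_line (\<lambda>n. proj_point (of_real (p n), of_real (q n))) L sequentially"
  from limitin_topspace[OF this] have "L \<in> proj_point ` (- {0})"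
    by (simp only: topspace_proj_line)
  then obtain u where u: "u \<noteq> 0" "L = proj_point u"
    by blast
  define C where "C = \<bar>e11\<bar> + \<bar>e12\<bar> + \<bar>e21\<bar> + \<bar>e22\<bar>"
  define H where "H = 4 * (\<bar>e21\<bar> + \<bar>e12\<bar>)"
  define \<delta> where "\<delta> = - ((e22 - e11)\<^sup>2 + 4 * e12 * e21)"
  \<comment> \<open>Chosen so that the upper bound for F becomes exactly half of the lower
    bound.\<close>
  define \<epsilon> where "\<epsilon> = \<delta> * norm u / (4 * H * C)"
  \<comment> \<open>Otherwise the discriminant would be a square, hence nonnegative. This makes
    \<open>C\<close> and \<open>H\<close> positive.\<close>
  have "e12 \<noteq> 0"
    using disc by auto
  then have pos: "C > 0" "H > 0" "\<delta> > 0" "norm u > 0"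
    using disc u(1) by (auto simp: C_def H_def \<delta>_def)
  then have "\<epsilon> > 0"
    by (simp add: \<epsilon>_def)
  have "(complex_of_real (p n), complex_of_real (q n)) \<noteq> 0" for n
    using nz[of n] by (simp add: zero_prod_def)
  from limitin_proj_pointD[OF lim[unfolded u(2)] u(1) this \<open>\<epsilon> > 0\<close>]
  obtain n0 where close:
    "cmod (of_real (p n) * snd u - of_real (q n) * fst u) < \<epsilon> * norm (p n, q n)" if "n \<ge> n0" for n
    by (auto simp: eventually_sequentially norm_of_real_pair)
  define n where "n = max N n0"
  have n: "n \<ge> N" "n \<ge> n0" "n + k \<ge> n0"
    by (auto simp: n_def)
  define r where "r = norm (p n, q n)"
  define r' where "r' = norm (p (n + k), q (n + k))"
  define F where "F = p n * q (n + k) - q n * p (n + k)"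
  have "r > 0"
    unfolding r_def zero_less_norm_iff by (rule nz)
  have r2: "r\<^sup>2 = (p n)\<^sup>2 + (q n)\<^sup>2"
    by (simp add: r_def norm_prod_def)
  have "r' \<le> C * r"
    unfolding r_def r'_def C_def recp[OF n(1)] recq[OF n(1)] by (rule norm_linear_image_2_le)
  have F: "F = e21 * (p n)\<^sup>2 + (e22 - e11) * p n * q n + (- e12) * (q n)\<^sup>2"
    unfolding F_def recp[OF n(1)] recq[OF n(1)] by (simp add: power2_eq_square algebra_simps)
  \<comment> \<open>Matches the coefficients of the form F with those of
    \<open>definite_form_lower_bound\<close>.\<close>
  have "\<delta> = 4 * e21 * (- e12) - (e22 - e11)\<^sup>2" "H = 4 * (\<bar>e21\<bar> + \<bar>- e12\<bar>)"
    by (simp_all add: \<delta>_def H_def)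
  then have "\<delta> * r\<^sup>2 \<le> H * \<bar>F\<bar>"
    unfolding F r2 using definite_form_lower_bound by metis
  then have "\<delta> * r\<^sup>2 * norm u \<le> H * (\<bar>F\<bar> * norm u)"
    using pos by (metis mult.assoc mult_le_cancel_right_pos)
  also have "\<dots> \<le> H * (2 * (\<epsilon> * r * r'))"
    unfolding F_def r_def r'_def
    using close[OF n(2)] close[OF n(3)] pos by (intro mult_left_mono norm_det_le_of_close) auto
  also have "\<dots> \<le> H * (2 * (\<epsilon> * r * (C * r)))"
    using \<open>r' \<le> C * r\<close> \<open>\<epsilon> > 0\<close> \<open>r > 0\<close> pos by simp
  also have "\<dots> = \<delta> * r\<^sup>2 * norm u / 2"
    using pos by (simp add: \<epsilon>_def power2_eq_square field_simps)
  finally have "\<delta> * r\<^sup>2 * norm u \<le> 0"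
    by linarith
  moreover have "\<delta> * r\<^sup>2 * norm u > 0"
    using pos \<open>r > 0\<close> by simp
  ultimately show False
    by simp
qed

section \<open>The two signs of the discriminant over the quadratic field\<close>

theorem lemma1:
  fixes K :: "real set" and a :: "nat \<Rightarrow> real" and N k :: nat
  assumes "real_quadratic_field K"
    and "ultimately_periodic_cf a N k"
    and "\<And>i. a i \<in> ring_of_integers K"
  shows "(cf_disc a N k > 0 \<and> \<not> (\<exists>x\<in>K. cf_disc a N k = x\<^sup>2) \<longrightarrow>
            cf_converges (\<lambda>i. complex_of_real (a i))) \<and>
         (cf_disc a N k < 0 \<longrightarrow> \<not> cf_converges (\<lambda>i. complex_of_real (a i)))"
proof (intro conjI impI)
  have K: "is_subfield K"
    using assms(1) by (simp add: real_quadratic_field_def)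
  have "a i \<in> K" for i
    using assms(3)[of i] by (simp add: ring_of_integers_def)
  then have PQ: "cf_P a n \<in> K" "cf_Q a n \<in> K" for n
    using cf_P_Q_in_subfield[OF K] by blast+
  have diff: "x - y \<in> K" and divide: "x / y \<in> K" if "x \<in> K" "y \<in> K" for x y
    using K that unfolding is_subfield_def diff_conv_add_uminus divide_inverse by blast+
  define t where "t = cf_E a N k $ 1 $ 1 + cf_E a N k $ 2 $ 2"
  define d :: real where "d = (- 1) ^ k"
  have disc: "cf_disc a N k = t\<^sup>2 - 4 * d"
    by (simp add: cf_disc_eq_trace_det t_def d_def)
  have d_cases: "d = 1 \<or> d = - 1"
    unfolding d_def by (rule minus_one_power_iff[THEN ssubst]) simp
  have one: "1 \<in> K" "- 1 \<in> K"
    using K by (auto simp: is_subfield_def)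
  have dK: "d \<in> K"
    using one d_cases by auto
  assume A: "cf_disc a N k > 0 \<and> \<not> (\<exists>x\<in>K. cf_disc a N k = x\<^sup>2)"
  \<comment> \<open>This element is 2. Trace zero and a positive discriminant would force d = -1 and
    discriminant 4, a square in \<open>K\<close>.\<close>
  have "1 - (- 1) \<in> K"
    using one by (rule diff)
  then have "cf_disc a N k \<noteq> (1 - (- 1))\<^sup>2"
    using A by blast
  then have "t \<noteq> 0"
    using A d_cases by (auto simp: disc)
  with A obtain l m where lm: "l + m = t" "l * m = d" "(l - m)\<^sup>2 = t\<^sup>2 - 4 * d" "\<bar>m\<bar> < \<bar>l\<bar>"
    using dominant_root disc by metis
  \<comment> \<open>If m were in \<open>K\<close>, so would be l = d / m, and the discriminant would
    be the square of l - m.\<close>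
  have "m \<notin> K"
  proof
    assume "m \<in> K"
    moreover have "l = d / m"
      using lm(2) d_cases by (cases "m = 0") (auto simp: field_simps)
    ultimately have "l - m \<in> K"
      using diff divide dK by metis
    with A lm(3) show False
      by (metis disc)
  qed
  \<comment> \<open>A nonzero vector over \<open>K\<close> with image over \<open>K\<close> has its
    eigenvalue in \<open>K\<close>, as a quotient of entries.\<close>
  have not_eigen: "(cf_P a (n + k), cf_Q a (n + k)) \<noteq> (m * cf_P a n, m * cf_Q a n)" for n
  proof
    assume eq: "(cf_P a (n + k), cf_Q a (n + k)) = (m * cf_P a n, m * cf_Q a n)"
    show False
    proof (cases "cf_P a n = 0")
      case True
      then have "m = cf_Q a (n + k) / cf_Q a n"
        using eq cf_P_cf_Q_nonzero[of a n] by (auto simp: zero_prod_def)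
      with divide PQ \<open>m \<notin> K\<close> show False
        by metis
    next
      case False
      then have "m = cf_P a (n + k) / cf_P a n"
        using eq by auto
      with divide PQ \<open>m \<notin> K\<close> show False
        by metis
    qed
  qed
  show "cf_converges (\<lambda>i. complex_of_real (a i))"
    unfolding cf_converges_def cf_P_of_real cf_Q_of_real
  proof (rule power_iteration_convergent)
    show "k \<ge> 1"
      using assms(2) by (simp add: ultimately_periodic_cf_def)
    show "l * m = cf_E a N k $ 1 $ 1 * cf_E a N k $ 2 $ 2 - cf_E a N k $ 1 $ 2 * cf_E a N k $ 2 $ 1"
      using det_cf_E[of a N k] lm(2) by (simp add: det_2 d_def)
  qed (use cf_convergent_shift[OF assms(2)] lm not_eigen in \<open>auto simp: t_def\<close>)
next
  assume "cf_disc a N k < 0"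
  then show "\<not> cf_converges (\<lambda>i. complex_of_real (a i))"
    unfolding cf_converges_def cf_P_of_real cf_Q_of_real
    using elliptic_iteration_divergent[where p = "cf_P a" and q = "cf_Q a",
        OF cf_convergent_shift[OF assms(2)] _ cf_P_cf_Q_nonzero]
    by (simp add: cf_disc_def Let_def)
qed

end
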